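(* Let $\theta$ be a measure preserving transformation of a measure space $(X,\Sigma,\nu)$. Let $f\in L^2(\nu)$ be such that there exists $\beta>1$ with $$\sum_{n\ge 3}\frac{\big\|\sum_{k=1}^nf\circ\theta^k\big\|_{L^2(\nu)}^2}{n^2\log n\,(\log\log n)^\beta}<+\infty .$$ Then $$\frac{1}{\sqrt n\,\log n\,(\log\log n)^{\beta/2}}\sum_{k=1}^nf\circ\theta^k\longrightarrow 0\qquad\nu\text{-a.s. as } n\to+\infty .$$ *)

theory Defs
  imports "HOL-Analysis.Analysis"
begin

definition measure_preserving :: "'a measure \<Rightarrow> ('a \<Rightarrow> 'a) \<Rightarrow> bool" where
  "measure_preserving M T \<longleftrightarrow>
     T \<in> measurable M M \<and> (\<forall>A\<in>sets M. emeasure M (T -` A \<inter> space M) = emeasure M A)"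

text \<open>
  The functions themselves, not their classes modulo equality almost everywhere.
  Below, the values lie in a type of sort \<open>{real_normed_field, euclidean_space}\<close>, which
  has, up to isomorphism, exactly the two scalar fields \<open>real\<close> and \<open>complex\<close> as models.
\<close>
definition L2 :: "'a measure \<Rightarrow> ('a \<Rightarrow> 'b::{real_normed_field, euclidean_space}) set" where
  "L2 M = {f \<in> borel_measurable M. integrable M (\<lambda>x. (norm (f x))\<^sup>2)}"

text \<open>Only meaningful on \<open>L2 M\<close>: the Bochner integral of a non-integrable function is \<open>0\<close>.\<close>
definition L2_norm :: "'a measure \<Rightarrow> ('a \<Rightarrow> 'b::{real_normed_field, euclidean_space}) \<Rightarrow> real" where
  "L2_norm M f = sqrt (\<integral>x. (norm (f x))\<^sup>2 \<partial>M)"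

end

theory Submission
  imports Defs
begin

text \<open>
  Write \<open>S n\<close> for the sum of \<open>f \<circ> \<theta> ^^ k\<close> over \<open>1 \<le> k \<le> n\<close>. Reading off the binary digits of \<open>n\<close>
  cuts \<open>S n x\<close> into blocks \<open>S (2 ^ j) ((\<theta> ^^ (i * 2 ^ j)) x)\<close>, at most one for each \<open>j\<close>, with
  \<open>(i + 1) * 2 ^ j \<le> n\<close>. Everything rests on bounding, for each \<open>j\<close> separately, all these blocks at once.

  The bound allows a block of length \<open>2 ^ j\<close> starting at \<open>i * 2 ^ j\<close> to have size
  \<open>sqrt ((i + 1) * 2 ^ j) * (t j + p j x)\<close>, where \<open>t j\<close> is a constant threshold and \<open>p j x\<close> is the sum over
  \<open>i\<close> of the excesses of the rescaled blocks over \<open>t j\<close>. All the blocks of one length have the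
  distribution of \<open>S (2 ^ j)\<close>, so the integral of \<open>p j\<close> is that of a sum of
  \<open>max 0 (g / sqrt (i + 1) - t j)\<close> with \<open>g = norm (S (2 ^ j)) / sqrt (2 ^ j)\<close>. Only the terms with
  \<open>i + 1 < (g / t j)\<^sup>2\<close> survive, whence the pointwise bound \<open>2 * g\<^sup>2 / t j\<close> (\<open>suminf_excess_le\<close>).
  One \<open>p j\<close> thus serves all \<open>i\<close>, hence all \<open>n\<close>. A maximal inequality on every
  range \<open>n < 2 ^ r\<close>, followed by summation over \<open>r\<close>, would cost a further factor \<open>sqrt (ln n)\<close>. Adding up
  the digits gives \<open>norm (S n x) \<le> sqrt n * (\<Sum>j\<le>r. t j + p j x)\<close> for \<open>n < 2 ^ (r + 1)\<close>
  (\<open>AE_birkhoff_sum_le\<close>).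

  Let \<open>t j = \<epsilon> * ln (j + 2) powr (\<beta> / 2)\<close> and \<open>d r = (r + 2) * ln (r + 2) powr (\<beta> / 2)\<close>. The thresholds
  contribute at most \<open>\<epsilon> * d r\<close>, and \<open>d r\<close> is of the order of \<open>ln n * ln (ln n) powr (\<beta> / 2)\<close> if
  \<open>2 ^ r \<le> n < 2 ^ (r + 1)\<close>. By the integral bound, \<open>\<Sum>j. p j / d j\<close> is integrable, hence finite almost
  everywhere, as soon as the squared norms of \<open>S (2 ^ j)\<close>, divided by
  \<open>2 ^ j * (j + 2) * ln (j + 2) powr \<beta>\<close>, are summable; Kronecker's lemma then makes the sum of
  \<open>p j x\<close> over \<open>j \<le> r\<close> of smaller order than \<open>d r\<close>.

  That dyadic summability is the hypothesis of the theorem, condensed along the powers of two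
  (\<open>summable_dyadic\<close>): the squared norms \<open>a n\<close> of \<open>S n\<close> need not be monotone, but
  \<open>a m \<le> 2 * a n + 2 * a (n + m)\<close> because \<open>S (n + m) - S n\<close> has the distribution of \<open>S m\<close>.
\<close>

section \<open>Square-integrable Birkhoff sums\<close>

definition birkhoff_sum :: "('a \<Rightarrow> 'a) \<Rightarrow> ('a \<Rightarrow> 'b::comm_monoid_add) \<Rightarrow> nat \<Rightarrow> 'a \<Rightarrow> 'b" where
  "birkhoff_sum T f n x = (\<Sum>k=1..n. (f \<circ> (T ^^ k)) x)"

lemma birkhoff_sum_add:
  "birkhoff_sum T f (m + n) x = birkhoff_sum T f m x + birkhoff_sum T f n ((T ^^ m) x)"
proof (induction n)
  case (Suc n)
  have "(T ^^ (m + Suc n)) x = (T ^^ Suc n) ((T ^^ m) x)"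
    by (metis add.commute comp_apply funpow_add)
  then show ?case
    using Suc by (simp add: birkhoff_sum_def add.assoc)
qed (simp add: birkhoff_sum_def)

lemma measure_preserving_distr:
  assumes "measure_preserving M T"
  shows "distr M M T = M"
proof (rule measure_eqI)
  fix A assume "A \<in> sets (distr M M T)"
  then show "emeasure (distr M M T) A = emeasure M A"
    using assms by (simp add: measure_preserving_def emeasure_distr)
qed simp

lemma measure_preserving_funpow:
  assumes "measure_preserving M T"
  shows "measure_preserving M (T ^^ k)"
proof -
  have T: "T \<in> measurable M M"
    using assms by (simp add: measure_preserving_def)
  have Tk: "(T ^^ k) \<in> measurable M M" for k
    using T by (induction k) (auto intro: measurable_comp)
  have "distr M M (T ^^ k) = M" for k
  proof (induction k)
    case 0
    then show ?case by (simp add: distr_id2 id_def)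
  next
    case (Suc k)
    have "distr M M (T ^^ Suc k) = distr (distr M M (T ^^ k)) M T"
      using T Tk[of k] by (simp add: distr_distr)
    then show ?case
      unfolding Suc measure_preserving_distr[OF assms] .
  qed
  then show ?thesis
    unfolding measure_preserving_def using Tk emeasure_distr[OF Tk] by metis
qed

lemma nn_integral_measure_preserving:
  assumes "measure_preserving M T" "h \<in> borel_measurable M"
  shows "(\<integral>\<^sup>+x. h (T x) \<partial>M) = (\<integral>\<^sup>+x. h x \<partial>M)"
proof -
  have "(\<integral>\<^sup>+x. h x \<partial>distr M M T) = (\<integral>\<^sup>+x. h (T x) \<partial>M)"
    using assms by (intro nn_integral_distr) (auto simp: measure_preserving_def)
  then show ?thesis
    by (simp add: measure_preserving_distr[OF assms(1)])
qed

lemma nn_integral_L2: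
  assumes "f \<in> L2 M"
  shows "(\<integral>\<^sup>+x. ennreal ((norm (f x))\<^sup>2) \<partial>M) = ennreal ((L2_norm M f)\<^sup>2)"
  using assms by (simp add: L2_def L2_norm_def nn_integral_eq_integral)

lemma L2_I:
  fixes f :: "'a \<Rightarrow> 'b::{real_normed_field, euclidean_space}"
  assumes "f \<in> borel_measurable M" "(\<integral>\<^sup>+x. ennreal ((norm (f x))\<^sup>2) \<partial>M) < \<infinity>"
  shows "f \<in> L2 M"
  using assms unfolding L2_def by (auto intro!: integrableI_bounded)

lemma L2_measure_preserving:
  fixes f :: "'a \<Rightarrow> 'b::{real_normed_field, euclidean_space}"
  assumes "measure_preserving M T" "f \<in> L2 M"
  shows "(\<lambda>x. f (T x)) \<in> L2 M" "L2_norm M (\<lambda>x. f (T x)) = L2_norm M f"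
proof -
  have [measurable]: "T \<in> measurable M M" "f \<in> borel_measurable M"
    using assms by (auto simp: measure_preserving_def L2_def)
  have *: "(\<integral>\<^sup>+x. ennreal ((norm (f (T x)))\<^sup>2) \<partial>M) = ennreal ((L2_norm M f)\<^sup>2)"
    using nn_integral_measure_preserving[OF assms(1), of "\<lambda>x. ennreal ((norm (f x))\<^sup>2)"]
      nn_integral_L2[OF assms(2)] by simp
  show L2: "(\<lambda>x. f (T x)) \<in> L2 M"
    by (rule L2_I) (use * in auto)
  show "L2_norm M (\<lambda>x. f (T x)) = L2_norm M f"
    using nn_integral_L2[OF L2] * by (simp add: L2_norm_def)
qed

lemma norm_diff_square_le:
  fixes a b :: "'b::real_normed_vector"
  shows "(norm (a - b))\<^sup>2 \<le> 2 * (norm a)\<^sup>2 + 2 * (norm b)\<^sup>2"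
proof -
  have "(norm (a - b))\<^sup>2 \<le> (norm a + norm b)\<^sup>2"
    by (simp add: norm_triangle_ineq4 power_mono)
  also have "\<dots> \<le> 2 * (norm a)\<^sup>2 + 2 * (norm b)\<^sup>2"
    using sum_squares_bound[of "norm a" "norm b"] by (simp add: power2_sum)
  finally show ?thesis .
qed

lemma L2_diff:
  fixes f g :: "'a \<Rightarrow> 'b::{real_normed_field, euclidean_space}"
  assumes f: "f \<in> L2 M" and g: "g \<in> L2 M"
  shows "(\<lambda>x. f x - g x) \<in> L2 M"
    and "(L2_norm M (\<lambda>x. f x - g x))\<^sup>2 \<le> 2 * (L2_norm M f)\<^sup>2 + 2 * (L2_norm M g)\<^sup>2"
proof -
  have [measurable]: "f \<in> borel_measurable M" "g \<in> borel_measurable M"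
    using assms by (auto simp: L2_def)
  have "(\<integral>\<^sup>+x. ennreal ((norm (f x - g x))\<^sup>2) \<partial>M)
      \<le> (\<integral>\<^sup>+x. 2 * ennreal ((norm (f x))\<^sup>2) + 2 * ennreal ((norm (g x))\<^sup>2) \<partial>M)"
  proof (rule nn_integral_mono)
    fix x
    have "ennreal ((norm (f x - g x))\<^sup>2) \<le> ennreal (2 * (norm (f x))\<^sup>2 + 2 * (norm (g x))\<^sup>2)"
      by (rule ennreal_leI[OF norm_diff_square_le])
    also have "\<dots> = 2 * ennreal ((norm (f x))\<^sup>2) + 2 * ennreal ((norm (g x))\<^sup>2)"
      by (simp add: ennreal_mult)
    finally show "ennreal ((norm (f x - g x))\<^sup>2)
        \<le> 2 * ennreal ((norm (f x))\<^sup>2) + 2 * ennreal ((norm (g x))\<^sup>2)" .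
  qed
  also have "\<dots> = 2 * ennreal ((L2_norm M f)\<^sup>2) + 2 * ennreal ((L2_norm M g)\<^sup>2)"
    by (simp add: nn_integral_add nn_integral_cmult nn_integral_L2[OF f] nn_integral_L2[OF g])
  also have "\<dots> = ennreal (2 * (L2_norm M f)\<^sup>2 + 2 * (L2_norm M g)\<^sup>2)"
    by (simp add: ennreal_mult)
  finally have le: "(\<integral>\<^sup>+x. ennreal ((norm (f x - g x))\<^sup>2) \<partial>M)
      \<le> ennreal (2 * (L2_norm M f)\<^sup>2 + 2 * (L2_norm M g)\<^sup>2)" .
  show L2: "(\<lambda>x. f x - g x) \<in> L2 M"
    by (rule L2_I) (use le in \<open>auto intro: le_less_trans\<close>)
  show "(L2_norm M (\<lambda>x. f x - g x))\<^sup>2 \<le> 2 * (L2_norm M f)\<^sup>2 + 2 * (L2_norm M g)\<^sup>2"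
    using le unfolding nn_integral_L2[OF L2] by (subst (asm) ennreal_le_iff) auto
qed

lemma L2_birkhoff_sum:
  fixes f :: "'a \<Rightarrow> 'b::{real_normed_field, euclidean_space}"
  assumes T: "measure_preserving M T" and f: "f \<in> L2 M"
  shows "birkhoff_sum T f n \<in> L2 M"
proof (induction n)
  case 0
  show ?case by (rule L2_I) (simp_all add: birkhoff_sum_def[abs_def])
next
  case (Suc n)
  let ?g = "\<lambda>x. 0 - f ((T ^^ Suc n) x)"
  have "(\<lambda>x. f x - f x) \<in> L2 M"
    by (rule L2_diff(1)[OF f f])
  then have "?g \<in> L2 M"
    using L2_diff(1)[of "\<lambda>_. 0" M] L2_measure_preserving(1)[OF measure_preserving_funpow[OF T] f, of "Suc n"]
    by simp
  from L2_diff(1)[OF Suc this] show ?case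
    by (simp add: birkhoff_sum_def[abs_def])
qed

text \<open>
  The increment over a time interval of length \<open>m\<close> is distributed as the sum of length \<open>m\<close>,
  wherever the interval starts. This substitutes for monotonicity in \<open>m\<close>.
\<close>
lemma L2_norm_birkhoff_sum_le:
  fixes f :: "'a \<Rightarrow> 'b::{real_normed_field, euclidean_space}"
  assumes T: "measure_preserving M T" and f: "f \<in> L2 M"
  shows "(L2_norm M (birkhoff_sum T f m))\<^sup>2
    \<le> 2 * (L2_norm M (birkhoff_sum T f n))\<^sup>2 + 2 * (L2_norm M (birkhoff_sum T f (n + m)))\<^sup>2"
proof -
  have "L2_norm M (birkhoff_sum T f m) = L2_norm M (\<lambda>x. birkhoff_sum T f m ((T ^^ n) x))"
    using L2_measure_preserving(2)[OF measure_preserving_funpow[OF T] L2_birkhoff_sum[OF T f]]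
    by simp
  also have "\<dots> = L2_norm M (\<lambda>x. birkhoff_sum T f (n + m) x - birkhoff_sum T f n x)"
    by (simp add: birkhoff_sum_add)
  finally show ?thesis
    using L2_diff(2)[OF L2_birkhoff_sum[OF T f] L2_birkhoff_sum[OF T f], of "n + m" n] by simp
qed

section \<open>Simultaneous control of all dyadic blocks\<close>

text \<open>
  The minimum on the right makes the bound inductive: as long as \<open>g / sqrt N\<close> exceeds \<open>t\<close> the bound
  grows like the sum of \<open>1 / sqrt (i + 1)\<close>, and afterwards both sides are stationary.
\<close>
lemma sum_excess_le:
  fixes g t :: real
  assumes "0 \<le> g" "0 < t"
  shows "(\<Sum>i<N. max 0 (g / sqrt (real (i + 1)) - t)) \<le> 2 * g * min (sqrt (real N)) (g / t)"
proof (induction N)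
  case 0
  then show ?case using assms by simp
next
  case (Suc N)
  define s where "s = sqrt (real (N + 1))"
  have s: "s > 0" by (simp add: s_def)
  have mono: "sqrt (real N) \<le> s" by (simp add: s_def)
  show ?case
  proof (cases "g / s \<le> t")
    case True
    have "2 * g * min (sqrt (real N)) (g / t) \<le> 2 * g * min s (g / t)"
      using mono assms by (intro mult_left_mono) auto
    then show ?thesis
      using Suc True by (simp add: s_def add.commute)
  next
    case False
    then have lt: "s < g / t"
      using s assms by (simp add: field_simps)
    \<comment> \<open>\<open>1 / sqrt (N + 1)\<close> is at most twice the increment of the square root from \<open>N\<close> to \<open>N + 1\<close>.\<close>
    have "1 = s\<^sup>2 - (sqrt (real N))\<^sup>2"
      by (simp add: s_def)
    also have "\<dots> = (s - sqrt (real N)) * (s + sqrt (real N))"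
      by (simp add: power2_eq_square algebra_simps)
    also have "\<dots> \<le> (s - sqrt (real N)) * (2 * s)"
      using mono by (intro mult_left_mono) auto
    finally have "1 / s \<le> 2 * (s - sqrt (real N))"
      using s by (simp add: field_simps)
    from mult_left_mono[OF this assms(1)]
    have step: "g / s \<le> 2 * g * s - 2 * g * sqrt (real N)"
      by (simp add: algebra_simps)
    have "min (sqrt (real N)) (g / t) = sqrt (real N)"
      using lt mono by simp
    with Suc have IH: "(\<Sum>i<N. max 0 (g / sqrt (real (i + 1)) - t)) \<le> 2 * g * sqrt (real N)"
      by (simp only:)
    have "(\<Sum>i<Suc N. max 0 (g / sqrt (real (i + 1)) - t))
        = (\<Sum>i<N. max 0 (g / sqrt (real (i + 1)) - t)) + max 0 (g / s - t)"
      by (simp add: s_def add.commute)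
    also have "\<dots> \<le> 2 * g * s"
      using IH step assms(2) False by linarith
    also have "s = min (sqrt (real (Suc N))) (g / t)"
      using lt by (simp add: s_def add.commute)
    finally show ?thesis .
  qed
qed

lemma suminf_excess_le:
  fixes g t :: real
  assumes "0 \<le> g" "0 < t"
  shows "(\<Sum>i. ennreal (max 0 (g / sqrt (real (i + 1)) - t))) \<le> ennreal (2 * g\<^sup>2 / t)"
proof (rule suminf_le_const)
  fix N
  have "2 * g * min (sqrt (real N)) (g / t) \<le> 2 * g * (g / t)"
    using assms by (intro mult_left_mono) auto
  then have "(\<Sum>i<N. max 0 (g / sqrt (real (i + 1)) - t)) \<le> 2 * g\<^sup>2 / t"
    using sum_excess_le[OF assms, of N] by (simp add: power2_eq_square)
  then show "(\<Sum>i<N. ennreal (max 0 (g / sqrt (real (i + 1)) - t))) \<le> ennreal (2 * g\<^sup>2 / t)"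
    by (simp add: sum_ennreal ennreal_leI)
qed simp

text \<open>
  Truncating the binary expansion of \<open>n\<close> at the digit \<open>l\<close> gives the times \<open>n div 2 ^ l * 2 ^ l\<close>. Lowering
  \<open>l\<close> by one either leaves this time unchanged or appends a single block of length \<open>2 ^ l\<close> that
  ends no later than \<open>n\<close>, so that its factor \<open>sqrt ((i + 1) * 2 ^ l)\<close> is at most \<open>sqrt n\<close>.
\<close>
lemma norm_birkhoff_sum_le_dyadic:
  fixes f :: "'a \<Rightarrow> 'b::real_normed_vector"
  assumes B: "\<And>j. 0 \<le> B j"
    and block: "\<And>j i. norm (birkhoff_sum T f (2 ^ j) ((T ^^ (i * 2 ^ j)) x))
                  \<le> sqrt (real ((i + 1) * 2 ^ j)) * B j"
    and n: "n < 2 ^ L"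
  shows "norm (birkhoff_sum T f n x) \<le> sqrt (real n) * (\<Sum>j<L. B j)"
proof -
  have "norm (birkhoff_sum T f (n div 2 ^ l * 2 ^ l) x) \<le> sqrt (real n) * (\<Sum>j=l..<L. B j)"
    if "l \<le> L" for l
    using that
  proof (induction rule: inc_induct)
    case base
    then show ?case using n by (simp add: birkhoff_sum_def)
  next
    case (step l)
    define q where "q = n div 2 ^ l"
    have q2: "n div 2 ^ Suc l = q div 2"
      by (simp add: q_def div_mult2_eq mult.commute[of 2])
    have IH: "norm (birkhoff_sum T f (q div 2 * 2 * 2 ^ l) x) \<le> sqrt (real n) * (\<Sum>j=Suc l..<L. B j)"
      using step.IH unfolding q2 by (simp add: mult.assoc)
    have split: "(\<Sum>j=l..<L. B j) = B l + (\<Sum>j=Suc l..<L. B j)"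
      using step.hyps by (simp add: sum.atLeast_Suc_lessThan)
    show ?case
    proof (cases "even q")
      case True
      then have "norm (birkhoff_sum T f (q * 2 ^ l) x) \<le> sqrt (real n) * (\<Sum>j=Suc l..<L. B j)"
        using IH by simp
      also have "\<dots> \<le> sqrt (real n) * (\<Sum>j=l..<L. B j)"
        unfolding split using B by (intro mult_left_mono) auto
      finally show ?thesis by (simp add: q_def)
    next
      case False
      define i where "i = q div 2 * 2"
      have qi: "q = i + 1"
        using odd_two_times_div_two_succ[OF False] by (simp only: i_def mult.commute)
      have "(i + 1) * 2 ^ l \<le> n"
        unfolding qi[symmetric] q_def by (simp add: div_times_less_eq_dividend)
      then have "sqrt (real ((i + 1) * 2 ^ l)) \<le> sqrt (real n)"
        by (simp only: real_sqrt_le_iff of_nat_le_iff)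
      then have "norm (birkhoff_sum T f (2 ^ l) ((T ^^ (i * 2 ^ l)) x)) \<le> sqrt (real n) * B l"
        using block[of l i] mult_right_mono[OF _ B[of l]] by (meson order_trans)
      moreover have "birkhoff_sum T f (q * 2 ^ l) x
          = birkhoff_sum T f (i * 2 ^ l) x + birkhoff_sum T f (2 ^ l) ((T ^^ (i * 2 ^ l)) x)"
        using birkhoff_sum_add[of T f "i * 2 ^ l" "2 ^ l" x] by (simp add: qi add.commute)
      ultimately have "norm (birkhoff_sum T f (q * 2 ^ l) x)
          \<le> sqrt (real n) * (\<Sum>j=Suc l..<L. B j) + sqrt (real n) * B l"
        using IH norm_triangle_ineq[of "birkhoff_sum T f (i * 2 ^ l) x"] unfolding i_def[symmetric]
        by (smt (verit))
      then show ?thesis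
        unfolding split by (simp add: q_def algebra_simps)
    qed
  qed
  from this[of 0] show ?thesis by (simp add: atLeast0LessThan)
qed

section \<open>Almost everywhere bounds\<close>

text \<open>
  For nonnegative terms Kronecker's lemma is dominated convergence for series: \<open>p k / d n\<close>
  tends to \<open>0\<close> in \<open>n\<close> and is at most \<open>p k / d k\<close> for \<open>k \<le> n\<close>.
\<close>
lemma nonneg_kronecker:
  fixes p d :: "nat \<Rightarrow> real"
  assumes p: "\<And>j. 0 \<le> p j" and d: "\<And>j. 0 < d j" and mono: "mono d"
    and lim: "filterlim d at_top sequentially"
    and summ: "summable (\<lambda>j. p j / d j)"
  shows "(\<lambda>r. (\<Sum>j\<le>r. p j) / d r) \<longlonglongrightarrow> 0"
proof -
  define a where "a k n = (if k \<le> n then p k / d n else 0)" for k n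
  have "(\<lambda>n. a k n) \<longlonglongrightarrow> 0" for k
  proof (rule Lim_transform_eventually)
    show "(\<lambda>n. p k / d n) \<longlonglongrightarrow> 0"
      by (rule real_tendsto_divide_at_top[OF tendsto_const lim])
    show "\<forall>\<^sub>F n in sequentially. p k / d n = a k n"
      using eventually_ge_at_top[of k] by eventually_elim (simp add: a_def)
  qed
  moreover have le: "norm (a k n) \<le> p k / d k" for k n
    using p[of k] d[of k] d[of n] monoD[OF mono, of k n]
    by (auto simp: a_def intro!: divide_left_mono)
  ultimately have "(\<lambda>n. \<Sum>k. a k n) \<longlonglongrightarrow> (\<Sum>k. 0)"
    using tannerys_theorem[of a "\<lambda>_. 0" sequentially "\<lambda>k. p k / d k"] summ
    by (auto intro!: always_eventually)
  moreover have "(\<Sum>k. a k n) = (\<Sum>j\<le>n. p j) / d n" for n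
    by (subst suminf_finite[of "{..n}"]) (auto simp: a_def sum_divide_distrib)
  ultimately show ?thesis by simp
qed

text \<open>
  Here \<open>p j\<close> is the total excess, over the threshold \<open>t j\<close>, of all the rescaled blocks of length
  \<open>2 ^ j\<close>. Its integral is at most twice the squared norm of \<open>S (2 ^ j)\<close> divided by \<open>2 ^ j * t j\<close>, so the hypothesis
  bounds the integral of \<open>\<Sum>j. p j / d j\<close>. The sequence \<open>p\<close> depends on the point \<open>x\<close>, but not on \<open>n\<close>.
\<close>
lemma AE_birkhoff_sum_le:
  fixes f :: "'a \<Rightarrow> 'b::{real_normed_field, euclidean_space}"
  assumes T: "measure_preserving M T" and f: "f \<in> L2 M"
    and t: "\<And>j. 0 < t j" and d: "\<And>j. 0 < d j"
    and summ: "summable (\<lambda>j. (L2_norm M (birkhoff_sum T f (2 ^ j)))\<^sup>2 / 2 ^ j / (t j * d j))"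
  shows "AE x in M. \<exists>p. (\<forall>j. 0 \<le> p j) \<and> summable (\<lambda>j. p j / d j) \<and>
    (\<forall>n L. n < 2 ^ L \<longrightarrow> norm (birkhoff_sum T f n x) \<le> sqrt (real n) * (\<Sum>j<L. t j + p j))"
proof -
  define g where "g j x = norm (birkhoff_sum T f (2 ^ j) x) / sqrt (2 ^ j)" for j x
  define e where "e j i y = max 0 (g j y / sqrt (real (i + 1)) - t j)" for j i y
  define q where "q j x = (\<Sum>i. ennreal (e j i ((T ^^ (i * 2 ^ j)) x)))" for j x
  define A where "A j = (L2_norm M (birkhoff_sum T f (2 ^ j)))\<^sup>2 / 2 ^ j" for j
  have S [measurable]: "birkhoff_sum T f n \<in> borel_measurable M" for n
    using L2_birkhoff_sum[OF T f] by (auto simp: L2_def)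
  have Tk [measurable]: "(T ^^ k) \<in> measurable M M" for k
    using measure_preserving_funpow[OF T] by (auto simp: measure_preserving_def)
  have g [measurable]: "g j \<in> borel_measurable M" for j
    unfolding g_def by measurable
  have e [measurable]: "e j i \<in> borel_measurable M" for j i
    unfolding e_def by measurable
  have q [measurable]: "q j \<in> borel_measurable M" for j
    unfolding q_def by measurable
  have g0: "0 \<le> g j x" for j x by (simp add: g_def)
  have int_q: "(\<integral>\<^sup>+x. q j x \<partial>M) \<le> ennreal (2 * A j / t j)" for j
  proof -
    have "(\<integral>\<^sup>+x. q j x \<partial>M) = (\<Sum>i. \<integral>\<^sup>+x. ennreal (e j i ((T ^^ (i * 2 ^ j)) x)) \<partial>M)"
      unfolding q_def by (rule nn_integral_suminf) measurable
    \<comment> \<open>Invariance of the measure allows all the blocks to be replaced by the first one.\<close>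
    also have "\<dots> = (\<Sum>i. \<integral>\<^sup>+y. ennreal (e j i y) \<partial>M)"
      by (intro suminf_cong nn_integral_measure_preserving measure_preserving_funpow[OF T]) measurable
    also have "\<dots> = (\<integral>\<^sup>+y. (\<Sum>i. ennreal (e j i y)) \<partial>M)"
      by (rule nn_integral_suminf[symmetric]) measurable
    also have "\<dots> \<le> (\<integral>\<^sup>+y. ennreal (2 / (t j * 2 ^ j)) * ennreal ((norm (birkhoff_sum T f (2 ^ j) y))\<^sup>2) \<partial>M)"
    proof (rule nn_integral_mono)
      fix y
      have "(\<Sum>i. ennreal (e j i y)) \<le> ennreal (2 * (g j y)\<^sup>2 / t j)"
        unfolding e_def by (rule suminf_excess_le[OF g0 t])
      also have "2 * (g j y)\<^sup>2 / t j = 2 / (t j * 2 ^ j) * (norm (birkhoff_sum T f (2 ^ j) y))\<^sup>2"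
        by (simp add: g_def power_divide field_simps)
      also have "ennreal \<dots> = ennreal (2 / (t j * 2 ^ j)) * ennreal ((norm (birkhoff_sum T f (2 ^ j) y))\<^sup>2)"
        using t[of j] by (intro ennreal_mult) auto
      finally show "(\<Sum>i. ennreal (e j i y)) \<le> \<dots>" .
    qed
    also have "\<dots> = ennreal (2 / (t j * 2 ^ j)) * ennreal ((L2_norm M (birkhoff_sum T f (2 ^ j)))\<^sup>2)"
      by (simp add: nn_integral_cmult nn_integral_L2[OF L2_birkhoff_sum[OF T f]])
    also have "\<dots> = ennreal (2 * A j / t j)"
      using t[of j] by (subst ennreal_mult[symmetric]) (auto simp: A_def field_simps)
    finally show ?thesis .
  qed
  have "(\<integral>\<^sup>+x. (\<Sum>j. q j x * ennreal (1 / d j)) \<partial>M) = (\<Sum>j. \<integral>\<^sup>+x. q j x * ennreal (1 / d j) \<partial>M)"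
    by (rule nn_integral_suminf) measurable
  also have "\<dots> = (\<Sum>j. (\<integral>\<^sup>+x. q j x \<partial>M) * ennreal (1 / d j))"
    by (simp add: nn_integral_multc)
  also have "\<dots> \<le> (\<Sum>j. ennreal (2 * (A j / (t j * d j))))"
  proof (rule suminf_le)
    fix j
    have "(\<integral>\<^sup>+x. q j x \<partial>M) * ennreal (1 / d j) \<le> ennreal (2 * A j / t j) * ennreal (1 / d j)"
      by (rule mult_right_mono[OF int_q]) simp
    also have "\<dots> = ennreal (2 * (A j / (t j * d j)))"
      using t[of j] d[of j] by (subst ennreal_mult[symmetric]) (auto simp: A_def)
    finally show "(\<integral>\<^sup>+x. q j x \<partial>M) * ennreal (1 / d j) \<le> \<dots>" .
  qed auto
  also have "\<dots> < top"
  proof -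
    have "summable (\<lambda>j. 2 * (A j / (t j * d j)))"
      using summable_mult[OF summ, of 2] by (simp add: A_def)
    moreover have "0 \<le> 2 * (A j / (t j * d j))" for j
      using t[of j] d[of j] by (simp add: A_def)
    ultimately show ?thesis
      by (subst suminf_ennreal2) auto
  qed
  finally have "(\<integral>\<^sup>+x. (\<Sum>j. q j x * ennreal (1 / d j)) \<partial>M) \<noteq> \<infinity>"
    by simp
  then have "AE x in M. (\<Sum>j. q j x * ennreal (1 / d j)) \<noteq> \<infinity>"
    by (intro nn_integral_PInf_AE) measurable
  then show ?thesis
  proof eventually_elim
    case (elim x)
    define p where "p j = enn2real (q j x)" for j
    have p0: "0 \<le> p j" for j by (simp add: p_def)
    have qp: "q j x = ennreal (p j)" for j
    proof -
      have "q j x * ennreal (1 / d j) < top"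
        using elim ennreal_suminf_lessD[of "\<lambda>j. q j x * ennreal (1 / d j)" top j]
        by (simp add: less_top)
      then have "q j x < top"
        using d[of j] by (auto simp: ennreal_mult_less_top)
      then show ?thesis by (simp add: p_def)
    qed
    have "summable (\<lambda>j. p j / d j)"
    proof (rule summable_suminf_not_top)
      have "ennreal (p j / d j) = q j x * ennreal (1 / d j)" for j
        using p0[of j] d[of j] by (simp add: qp ennreal_mult[symmetric])
      then show "(\<Sum>j. ennreal (p j / d j)) \<noteq> top"
        using elim by simp
    qed (use p0 d in \<open>simp add: less_imp_le\<close>)
    moreover have "norm (birkhoff_sum T f n x) \<le> sqrt (real n) * (\<Sum>j<L. t j + p j)"
      if "n < 2 ^ L" for n L
    proof (rule norm_birkhoff_sum_le_dyadic[OF _ _ that])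
      show "0 \<le> t j + p j" for j
        using t[of j] p0[of j] by simp
      fix j i
      let ?y = "(T ^^ (i * 2 ^ j)) x"
      have "ennreal (e j i ?y) \<le> q j x"
        unfolding q_def using sum_le_suminf[of "\<lambda>i. ennreal (e j i ((T ^^ (i * 2 ^ j)) x))" "{i}"] by simp
      then have "e j i ?y \<le> p j"
        using p0[of j] by (simp add: qp)
      then have "g j ?y / sqrt (real (i + 1)) \<le> t j + p j"
        by (simp add: e_def)
      then have "g j ?y \<le> (t j + p j) * sqrt (real (i + 1))"
        by (simp add: pos_divide_le_eq)
      then have "norm (birkhoff_sum T f (2 ^ j) ?y) \<le> (t j + p j) * sqrt (real (i + 1)) * sqrt (2 ^ j)"
        unfolding g_def by (simp add: pos_divide_le_eq)
      also have "\<dots> = sqrt (real ((i + 1) * 2 ^ j)) * (t j + p j)"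
        by (simp add: algebra_simps flip: real_sqrt_mult)
      finally show "norm (birkhoff_sum T f (2 ^ j) ?y) \<le> \<dots>" .
    qed
    ultimately show ?case using p0 by blast
  qed
qed

text \<open>
  Scaling the thresholds down to \<open>\<tau> j / (m + 1)\<close> multiplies the sum in the hypothesis by \<open>m + 1\<close>, which does
  not affect its convergence, and makes the share of the thresholds as small as desired. Countably
  many \<open>m\<close> suffice, so the exceptional set can be chosen independently of \<open>\<epsilon>\<close>.
\<close>
lemma AE_birkhoff_sum_small:
  fixes f :: "'a \<Rightarrow> 'b::{real_normed_field, euclidean_space}"
  assumes T: "measure_preserving M T" and f: "f \<in> L2 M"
    and \<tau>: "\<And>j. 0 < \<tau> j" and d: "\<And>j. 0 < d j" "mono d" "filterlim d at_top sequentially"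
    and \<tau>_le: "\<And>r. (\<Sum>j\<le>r. \<tau> j) \<le> d r"
    and summ: "summable (\<lambda>j. (L2_norm M (birkhoff_sum T f (2 ^ j)))\<^sup>2 / 2 ^ j / (\<tau> j * d j))"
  shows "AE x in M. \<forall>\<epsilon>>0. \<forall>\<^sub>F r in sequentially.
    \<forall>n<2 ^ Suc r. norm (birkhoff_sum T f n x) \<le> \<epsilon> * (sqrt (real n) * d r)"
proof -
  define t where "t m j = \<tau> j / real (Suc m)" for m j
  have "AE x in M. \<forall>m. \<exists>p. (\<forall>j. 0 \<le> p j) \<and> summable (\<lambda>j. p j / d j) \<and>
    (\<forall>n L. n < 2 ^ L \<longrightarrow> norm (birkhoff_sum T f n x) \<le> sqrt (real n) * (\<Sum>j<L. t m j + p j))"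
    unfolding AE_all_countable
  proof (intro allI AE_birkhoff_sum_le[OF T f])
    fix m
    show "0 < t m j" for j using \<tau>[of j] by (simp add: t_def)
    show "summable (\<lambda>j. (L2_norm M (birkhoff_sum T f (2 ^ j)))\<^sup>2 / 2 ^ j / (t m j * d j))"
      using summable_mult[OF summ, of "real (Suc m)"] by (simp add: t_def field_simps)
  qed (use d in auto)
  then show ?thesis
  proof eventually_elim
    case (elim x)
    show ?case
    proof (intro allI impI)
      fix \<epsilon> :: real assume "0 < \<epsilon>"
      then obtain m where m: "1 / real (Suc m) < \<epsilon> / 2"
        using nat_approx_posE[of "\<epsilon> / 2"] by auto
      obtain p where p: "\<And>j. 0 \<le> p j" "summable (\<lambda>j. p j / d j)"
        and S: "\<And>n L. n < 2 ^ L \<Longrightarrow>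
          norm (birkhoff_sum T f n x) \<le> sqrt (real n) * (\<Sum>j<L. t m j + p j)"
        using elim[rule_format, of m] by blast
      have "\<forall>\<^sub>F r in sequentially. (\<Sum>j\<le>r. p j) / d r < \<epsilon> / 2"
        using nonneg_kronecker[OF p(1) d p(2)] \<open>0 < \<epsilon>\<close> by (intro order_tendstoD) auto
      then show "\<forall>\<^sub>F r in sequentially.
        \<forall>n<2 ^ Suc r. norm (birkhoff_sum T f n x) \<le> \<epsilon> * (sqrt (real n) * d r)"
      proof eventually_elim
        case (elim r)
        have "(\<Sum>j\<le>r. t m j) = 1 / real (Suc m) * (\<Sum>j\<le>r. \<tau> j)"
          by (simp add: t_def sum_divide_distrib)
        also have "\<dots> \<le> \<epsilon> / 2 * d r"
          using m \<tau>_le[of r] \<open>0 < \<epsilon>\<close> by (intro mult_mono) (auto intro: sum_nonneg less_imp_le[OF \<tau>])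
        finally have "(\<Sum>j\<le>r. t m j) \<le> \<epsilon> / 2 * d r" .
        moreover have "(\<Sum>j\<le>r. p j) \<le> \<epsilon> / 2 * d r"
          using elim d(1)[of r] by (simp add: pos_divide_less_eq)
        ultimately have "(\<Sum>j<Suc r. t m j + p j) \<le> \<epsilon> * d r"
          by (simp add: lessThan_Suc_atMost sum.distrib)
        then have "sqrt (real n) * (\<Sum>j<Suc r. t m j + p j) \<le> \<epsilon> * (sqrt (real n) * d r)" for n
          using mult_left_mono[of _ "\<epsilon> * d r" "sqrt (real n)"] by (simp add: mult.left_commute)
        then show ?case
          using S[of _ "Suc r"] by (blast intro: order_trans)
      qed
    qed
  qed
qed

section \<open>Condensation along powers of two\<close>

text \<open>
  Summing \<open>a (2 ^ j) \<le> 2 * a n + 2 * a (n + 2 ^ j)\<close> over \<open>2 ^ j \<le> n < 2 ^ (j + 1)\<close> bounds \<open>2 ^ j * a (2 ^ j)\<close> by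
  twice the sum of \<open>a n\<close> over \<open>2 ^ j \<le> n < 2 ^ (j + 2)\<close>. Each \<open>n\<close> lies in only two of these ranges, so
  the sum over \<open>j\<close> is controlled by the full series.
\<close>
lemma summable_dyadic:
  fixes a v w :: "nat \<Rightarrow> real"
  assumes a: "\<And>n. 0 \<le> a n" "\<And>m n. a m \<le> 2 * a n + 2 * a (n + m)"
    and v: "\<And>n. 3 \<le> n \<Longrightarrow> 0 < v n" and w: "\<And>j. 0 < w j"
    and v_le: "\<And>j n. 2 ^ j \<le> n \<Longrightarrow> n < 2 ^ (j + 2) \<Longrightarrow> 4 \<le> n \<Longrightarrow> v n \<le> c * 4 ^ j * w j"
    and summ: "(\<lambda>n. a n / v n) summable_on {3..}"
  shows "summable (\<lambda>j. a (2 ^ j) / 2 ^ j / w j)"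
proof -
  define u where "u n = a n / v n" for n
  define V where "V j = (\<Sum>n=2^j..<2^Suc j. u n)" for j
  have u0: "0 \<le> u n" if "3 \<le> n" for n
    using a(1)[of n] v[OF that] by (simp add: u_def)
  have big: "4 \<le> n" if "2 ^ (j + 2) \<le> n" for j n :: nat
    using that by (intro order_trans[of 4 "2 ^ (j + 2)" n]) simp_all
  have partial: "(\<Sum>j<N. V (j + 2)) = (\<Sum>n=4..<2^(N+2). u n)" for N
  proof (induction N)
    case (Suc N)
    have "(\<Sum>n=4..<2^(N+2). u n) + V (N + 2) = (\<Sum>n=4..<2^Suc (N+2). u n)"
      unfolding V_def by (rule sum.atLeastLessThan_concat) (simp_all add: big)
    then show ?case using Suc by simp
  qed simp
  obtain I where I: "((\<lambda>n. a n / v n) has_sum I) {3..}"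
    using summ by (auto simp: summable_on_def)
  have "summable (\<lambda>j. V (j + 2))"
  proof (rule summableI_nonneg_bounded)
    show "0 \<le> V (j + 2)" for j
      unfolding V_def using big[of j] by (intro sum_nonneg u0) fastforce
    show "(\<Sum>j<N. V (j + 2)) \<le> I" for N
      unfolding partial u_def
      by (rule finite_sum_le_has_sum[OF I]) (use u0 in \<open>auto simp: u_def\<close>)
  qed
  \<comment> \<open>The blocks \<open>V 0\<close> and \<open>V 1\<close> contain terms outside the range of the hypothesis, whose sign is unknown.\<close>
  then have V: "summable V" by (subst (asm) summable_iff_shift)
  then have "summable (\<lambda>j. 2 * c * (V j + V (Suc j)))"
    by (intro summable_mult summable_add) (simp_all add: summable_Suc_iff)
  moreover have "\<forall>\<^sub>F j in sequentially. norm (a (2 ^ j) / 2 ^ j / w j) \<le> 2 * c * (V j + V (Suc j))"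
    using eventually_ge_at_top[of 2]
  proof eventually_elim
    case (elim j)
    then obtain i where i: "j = i + 2" by (metis le_Suc_ex add.commute)
    have "2 ^ j * a (2 ^ j) = (\<Sum>n=(2::nat)^j..<2^Suc j. a (2 ^ j))"
      by simp
    also have "\<dots> \<le> (\<Sum>n=2^j..<2^Suc j. 2 * a n + 2 * a (n + 2 ^ j))"
      by (intro sum_mono a(2))
    also have "\<dots> = 2 * ((\<Sum>n=2^j..<2^Suc j. a n) + (\<Sum>n=2^j..<2^Suc j. a (n + 2 ^ j)))"
      by (simp add: sum.distrib sum_distrib_left)
    also have "(\<Sum>n=2^j..<2^Suc j. a (n + 2 ^ j)) = (\<Sum>n=2^j+2^j..<2^Suc j+2^j. a n)"
      by (rule sum.shift_bounds_nat_ivl[symmetric])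
    also have "\<dots> \<le> (\<Sum>n=2^Suc j..<2^Suc (Suc j). a n)"
      by (intro sum_mono2) (auto intro: a(1))
    also have "(\<Sum>n=2^j..<2^Suc j. a n) + (\<Sum>n=2^Suc j..<2^Suc (Suc j). a n)
        = (\<Sum>n=2^j..<2^Suc (Suc j). a n)"
      by (rule sum.atLeastLessThan_concat) simp_all
    also have "\<dots> \<le> (\<Sum>n=2^j..<2^Suc (Suc j). c * 4 ^ j * w j * u n)"
    proof (rule sum_mono)
      fix n :: nat assume n: "n \<in> {2^j..<2^Suc (Suc j)}"
      then have n4: "4 \<le> n" using big[of i n] i by simp
      have "a n = v n * u n" using v[of n] n4 by (simp add: u_def)
      also have "\<dots> \<le> c * 4 ^ j * w j * u n"
        using n n4 u0[of n] v_le[of j n] by (intro mult_right_mono) auto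
      finally show "a n \<le> \<dots>" .
    qed
    also have "\<dots> = c * 4 ^ j * w j * (\<Sum>n=2^j..<2^Suc (Suc j). u n)"
      by (simp add: sum_distrib_left)
    also have "(\<Sum>n=2^j..<2^Suc (Suc j). u n) = V j + V (Suc j)"
      unfolding V_def by (rule sum.atLeastLessThan_concat[symmetric]) simp_all
    finally have "2 ^ j * a (2 ^ j) \<le> 2 * (c * 4 ^ j * w j * (V j + V (Suc j)))"
      by simp
    also have "\<dots> = 2 ^ j * (2 ^ j * w j * (2 * c * (V j + V (Suc j))))"
    proof -
      have "(4::real) ^ j = 2 ^ j * 2 ^ j" by (simp flip: power_mult_distrib)
      then show ?thesis by (simp only: mult_ac)
    qed
    finally have "a (2 ^ j) \<le> 2 ^ j * w j * (2 * c * (V j + V (Suc j)))"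
      by (simp only: mult_le_cancel_left_pos zero_less_power zero_less_numeral)
    then have "a (2 ^ j) / 2 ^ j / w j \<le> 2 * c * (V j + V (Suc j))"
      using w[of j] by (simp add: divide_simps mult_ac)
    then show ?case
      using a(1)[of "2 ^ j"] w[of j] by simp
  qed
  ultimately show ?thesis by (rule summable_comparison_test_ev[rotated])
qed

section \<open>Comparison of the logarithmic weights\<close>

lemma one_le_ln: "1 \<le> ln (real n)" if "3 \<le> n"
proof -
  have "exp 1 \<le> real n"
    using e_less_272 that by linarith
  then have "ln (exp 1) \<le> ln (real n)"
    by (subst ln_le_cancel_iff) (use that in auto)
  then show ?thesis by simp
qed

lemma loglog_weight_le:
  assumes \<beta>: "0 \<le> \<beta>" and n: "3 \<le> n" "n < 2 ^ (j + 2)"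
  shows "real n ^ 2 * ln (real n) * ln (ln (real n)) powr \<beta>
    \<le> 16 * 4 ^ j * ((real j + 2) * ln (real j + 2) powr \<beta>)"
proof -
  have le: "real n \<le> 2 ^ (j + 2)"
    using n(2) by (metis less_imp_le of_nat_le_iff of_nat_numeral of_nat_power)
  have "real n ^ 2 \<le> (2 ^ (j + 2)) ^ 2"
    using le by (intro power_mono) auto
  also have "(2 ^ (j + 2)) ^ 2 = 16 * (4::real) ^ j"
    by (simp add: power_add power_mult_distrib power2_eq_square flip: power_mult_distrib)
  finally have 1: "real n ^ 2 \<le> 16 * 4 ^ j" .
  have "ln (real n) \<le> ln (2 ^ (j + 2))"
    using le n by (subst ln_le_cancel_iff) auto
  also have "\<dots> = (real j + 2) * ln 2"
    by (subst ln_realpow) simp_all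
  also have "\<dots> \<le> (real j + 2) * 1"
    using ln_2_less_1 by (intro mult_left_mono) auto
  finally have 2: "ln (real n) \<le> real j + 2" by simp
  have "ln (ln (real n)) \<le> ln (real j + 2)"
    using 2 one_le_ln[OF n(1)] by (subst ln_le_cancel_iff) auto
  then have 3: "ln (ln (real n)) powr \<beta> \<le> ln (real j + 2) powr \<beta>"
    using \<beta> one_le_ln[OF n(1)] by (intro powr_mono2) auto
  have "real n ^ 2 * (ln (real n) * ln (ln (real n)) powr \<beta>)
    \<le> 16 * 4 ^ j * ((real j + 2) * ln (real j + 2) powr \<beta>)"
    using 1 2 3 one_le_ln[OF n(1)] by (intro mult_mono) auto
  then show ?thesis by (simp only: mult.assoc)
qed

text \<open>
  From \<open>r \<ge> 6\<close> and \<open>ln 2 \<ge> 2 / 3\<close> one gets \<open>ln n \<ge> 4\<close> and \<open>r + 2 \<le> 2 * ln n \<le> (ln n)\<^sup>2\<close>; the last square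
  accounts for the factor \<open>2\<close> inside the iterated logarithm.
\<close>
lemma loglog_weight_ge:
  assumes \<gamma>: "0 \<le> \<gamma>" and r: "6 \<le> r" "2 ^ r \<le> n"
  shows "(real r + 2) * ln (real r + 2) powr \<gamma>
    \<le> 2 * 2 powr \<gamma> * (ln (real n) * ln (ln (real n)) powr \<gamma>)"
proof -
  define L where "L = ln (real n)"
  have le: "2 ^ r \<le> real n"
    using r(2) by (metis of_nat_le_iff of_nat_numeral of_nat_power)
  have n: "0 < real n"
    by (rule less_le_trans[OF _ le]) simp
  have "real r * (2 / 3) \<le> real r * ln 2"
    using ln2_ge_two_thirds by (intro mult_left_mono) auto
  also have "\<dots> = ln (2 ^ r)"
    by (simp add: ln_realpow)
  also have "\<dots> \<le> L"
    unfolding L_def using le n by (subst ln_le_cancel_iff) auto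
  finally have L: "real r * (2 / 3) \<le> L" .
  then have L4: "4 \<le> L" and r2: "real r + 2 \<le> 2 * L"
    using r(1) by linarith+
  have "2 * L \<le> L ^ 2"
    using L4 by (simp add: power2_eq_square)
  then have "ln (real r + 2) \<le> ln (L ^ 2)"
    using r2 L4 by (subst ln_le_cancel_iff) auto
  also have "\<dots> = 2 * ln L"
    using L4 by (simp add: ln_realpow)
  finally have "ln (real r + 2) powr \<gamma> \<le> (2 * ln L) powr \<gamma>"
    using \<gamma> by (intro powr_mono2) auto
  also have "\<dots> = 2 powr \<gamma> * ln L powr \<gamma>"
    using L4 by (simp add: powr_mult)
  finally have "(real r + 2) * ln (real r + 2) powr \<gamma> \<le> 2 * L * (2 powr \<gamma> * ln L powr \<gamma>)"
    using r2 L4 by (intro mult_mono) auto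
  then show ?thesis by (simp add: L_def mult_ac)
qed

section \<open>The rate of convergence\<close>

theorem theorem4p5:
  fixes \<nu> :: "'a measure"
    and \<theta> :: "'a \<Rightarrow> 'a"
    and f :: "'a \<Rightarrow> 'b::{real_normed_field, euclidean_space}"
    and \<beta> :: real
  assumes "measure_preserving \<nu> \<theta>"
    and "f \<in> L2 \<nu>"
    and "\<beta> > 1"
    and "(\<lambda>n::nat. (L2_norm \<nu> (\<lambda>x. \<Sum>k=1..n. (f \<circ> (\<theta> ^^ k)) x))\<^sup>2
            / (real n ^ 2 * ln (real n) * (ln (ln (real n))) powr \<beta>)) summable_on {3..}"
  shows "AE x in \<nu>.
           (\<lambda>n::nat. (1 / (sqrt (real n) * ln (real n) * (ln (ln (real n))) powr (\<beta> / 2)))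
              *\<^sub>R (\<Sum>k=1..n. (f \<circ> (\<theta> ^^ k)) x)) \<longlonglongrightarrow> 0"
proof -
  note T = assms(1) and f = assms(2)
  define \<tau> where "\<tau> j = ln (real j + 2) powr (\<beta> / 2)" for j
  define d where "d j = (real j + 2) * \<tau> j" for j
  define v where "v n = real n ^ 2 * ln (real n) * (ln (ln (real n))) powr \<beta>" for n
  define C where "C = 2 * 2 powr (\<beta> / 2)"
  have \<tau>_pos: "0 < \<tau> j" for j by (simp add: \<tau>_def)
  have \<tau>_mono: "\<tau> i \<le> \<tau> j" if "i \<le> j" for i j
    unfolding \<tau>_def using that assms(3) by (intro powr_mono2) auto
  have d_pos: "0 < d j" for j using \<tau>_pos[of j] by (simp add: d_def)
  have d_mono: "mono d"
    unfolding d_def using \<tau>_mono \<tau>_pos by (intro monoI mult_mono) (auto intro: less_imp_le)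
  have d_lim: "filterlim d at_top sequentially"
  proof (rule filterlim_at_top_mono)
    show "filterlim (\<lambda>j. \<tau> 0 * real j) at_top sequentially"
      by (rule filterlim_tendsto_pos_mult_at_top[OF tendsto_const \<tau>_pos filterlim_real_sequentially])
    show "\<forall>\<^sub>F j in sequentially. \<tau> 0 * real j \<le> d j"
    proof (intro always_eventually allI)
      fix j
      show "\<tau> 0 * real j \<le> d j"
        using mult_mono[OF \<tau>_mono[of 0 j], of "real j" "real j + 2"] \<tau>_pos[of j]
        by (simp add: d_def mult.commute)
    qed
  qed
  have \<tau>_sum: "(\<Sum>j\<le>r. \<tau> j) \<le> d r" for r
  proof -
    have "(\<Sum>j\<le>r. \<tau> j) \<le> (\<Sum>j\<le>r. \<tau> r)"
      by (intro sum_mono \<tau>_mono) simp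
    also have "\<dots> \<le> d r"
      using \<tau>_pos[of r] by (simp add: d_def)
    finally show ?thesis .
  qed
  \<comment> \<open>The split of the dyadic weight into \<open>\<tau>\<close> and \<open>d\<close> is chosen so that the sum of \<open>\<tau>\<close> up to \<open>r\<close> is at most \<open>d r\<close>.\<close>
  have weight: "\<tau> j * d j = (real j + 2) * ln (real j + 2) powr \<beta>" for j
    by (simp add: \<tau>_def d_def flip: powr_add)
  have "summable (\<lambda>j. (L2_norm \<nu> (birkhoff_sum \<theta> f (2 ^ j)))\<^sup>2 / 2 ^ j / (\<tau> j * d j))"
  proof (rule summable_dyadic)
    show "(\<lambda>n. (L2_norm \<nu> (birkhoff_sum \<theta> f n))\<^sup>2 / v n) summable_on {3..}"
      using assms(4) by (simp add: v_def birkhoff_sum_def[abs_def])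
    show "v n \<le> 16 * 4 ^ j * (\<tau> j * d j)" if "n < 2 ^ (j + 2)" "4 \<le> n" for j n
      unfolding v_def weight using that assms(3) by (intro loglog_weight_le) auto
    show "0 < v n" if "3 \<le> n" for n
    proof -
      have "exp 1 < real n"
        using e_less_272 that by linarith
      then have "1 < ln (real n)"
        using that by (metis exp_gt_zero ln_exp ln_less_cancel_iff less_trans)
      then show ?thesis using that by (simp add: v_def)
    qed
  qed (use \<tau>_pos d_pos L2_norm_birkhoff_sum_le[OF T f] in auto)
  from AE_birkhoff_sum_small[OF T f \<tau>_pos d_pos d_mono d_lim \<tau>_sum this]
  show ?thesis
  proof eventually_elim
    case (elim x)
    show ?case
    proof (rule LIMSEQ_I)
      fix e :: real assume e: "0 < e"
      have C: "0 < C" by (simp add: C_def)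
      obtain R where R: "\<And>r n. R \<le> r \<Longrightarrow> n < 2 ^ Suc r \<Longrightarrow>
          norm (birkhoff_sum \<theta> f n x) \<le> e / (2 * C) * (sqrt (real n) * d r)"
        using elim[rule_format, of "e / (2 * C)"] e C by (auto simp: eventually_sequentially)
      have "norm ((1 / (sqrt (real n) * ln (real n) * (ln (ln (real n))) powr (\<beta> / 2)))
              *\<^sub>R (\<Sum>k=1..n. (f \<circ> (\<theta> ^^ k)) x)) < e" if n: "2 ^ max 6 R \<le> n" for n
      proof -
        have "1 \<le> n" using n one_le_power[of "2::nat" "max 6 R"] by linarith
        then obtain r where r: "2 ^ r \<le> n" "n < 2 ^ Suc r"
          using ex_power_ivl1[of 2 n] by auto
        have "2 ^ max 6 R < (2::nat) ^ Suc r"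
          using n r(2) by linarith
        then have "max 6 R \<le> r"
          by (subst (asm) power_strict_increasing_iff) auto
        then have rR: "6 \<le> r" "R \<le> r" by auto
        define K where "K = ln (real n) * ln (ln (real n)) powr (\<beta> / 2)"
        have dK: "d r \<le> C * K"
          unfolding d_def \<tau>_def C_def K_def
          using loglog_weight_ge[OF _ rR(1) r(1), of "\<beta> / 2"] assms(3) by simp
        have K: "0 < K"
          using dK d_pos[of r] C by (smt (verit) zero_less_mult_pos)
        have "norm (birkhoff_sum \<theta> f n x) \<le> e / (2 * C) * (sqrt (real n) * (C * K))"
          using R[OF rR(2) r(2)] dK e C
          by (elim order_trans) (intro mult_left_mono, auto)
        also have "\<dots> = e / 2 * (sqrt (real n) * K)"
          using C by simp
        also have "\<dots> < e * (sqrt (real n) * K)"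
          using e K \<open>1 \<le> n\<close> by simp
        finally have "norm (birkhoff_sum \<theta> f n x) / (sqrt (real n) * K) < e"
          using K \<open>1 \<le> n\<close> by (simp add: pos_divide_less_eq)
        moreover have "0 < sqrt (real n) * K"
          using K \<open>1 \<le> n\<close> by simp
        ultimately show ?thesis
          unfolding birkhoff_sum_def K_def mult.assoc[symmetric] by simp
      qed
      then show "\<exists>n0. \<forall>n\<ge>n0. norm ((1 / (sqrt (real n) * ln (real n) * (ln (ln (real n))) powr (\<beta> / 2)))
              *\<^sub>R (\<Sum>k=1..n. (f \<circ> (\<theta> ^^ k)) x) - 0) < e"
        by (metis diff_zero)
    qed
  qed
qed

end
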